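(* Let $\delta>0$ and consider an arbitrary prior distribution on $\Theta^\delta$ with posterior $\Pi^n$ (see context). Suppose the posterior satisfies the model consistency condition: for every true function $\theta_0\in\Theta^\delta$, with number of change-points denoted $k_0$, $\Pi^n(k=k_0)\to1$ in $P_0^n$-probability. Put $\epsilon_n=1/\sqrt n$. Then the maximal $L_2$ convergence is slower than the parametric rate: there exists a sequence $M_n\to\infty$ such that $$\sup_{\bar\theta\in\Theta^\delta}E_{Z|\bar\theta}\,\Pi^n\big(\theta\in\Theta^\delta:\ \|\theta-\bar\theta\|>M_n\epsilon_n\big)\to1\quad\text{as }n\to\infty .$$
   Context: Model space. Fix an integer $k_{max}$ (an a priori upper bound on the number of segments), $K>0$ and $\delta>0$. For $1\le k\le k_{max}$ let $\Theta_k^\delta$ be the set of step functions $\theta(x)=\sum_{j=1}^k a_j I(t_{j-1}\le x<t_j)$ on $[0,1)$ with $0=t_0<t_1<\dots<t_k=1$, $|a_j|\le K$ and $\min_{1\le j\le k}|t_j-t_{j-1}|\ge\delta$; such a $\theta$ is said to have $k$ change-points (i.e. $k$ segments), so $\Theta_1^\delta$ consists of constant functions. $\Theta^\delta=\bigcup_{k=1}^{k_{max}}\Theta_k^\delta$. The number of change-points $k_0$ of a true function $\theta_0$ refers to its representation with distinct adjacent levels. The norm is $\|\theta\|=(\int_0^1\theta^2(x)\,dx)^{1/2}$. Data. One observes i.i.d. $Z_i=(X_i,Y_i)$, $i=1,\dots,n$, with $X_i$ uniform on $[0,1)$ and $Y_i=\theta_0(X_i)+\varepsilon_i$, where the $\varepsilon_i\sim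 N(0,1)$ are i.i.d. and independent of the $X_i$, and $\theta_0\in\Theta^\delta$ is the true function. $P_\theta$ is the law of one observation under $\theta$, with density $p_\theta$; $P_0^n$ is the law of $Z=(Z_1,\dots,Z_n)$ under $\theta_0$, and $E_{Z|\bar\theta}$ is expectation when the true function is $\bar\theta$. Posterior. For a prior $\Pi$ on $\Theta^\delta$, $\Pi^n(A)=\int_A\prod_{i=1}^np_\theta(Z_i)\,d\Pi(\theta)\big/\int\prod_{i=1}^np_\theta(Z_i)\,d\Pi(\theta)$, and $\Pi^n(k=k_0)=\Pi^n(\Theta_{k_0}^\delta)$. No specific form of the prior is assumed.
   Formalization: The formal theorem assumes k_max ≥ 2 and δ ≤ 1/2, so that Θ^δ contains non-constant functions; otherwise Θ^δ has only constants (or is empty), consistency is automatic, and a uniform prior on the level attains rate 1/√n, so the claim fails. *)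

theory Defs
  imports "HOL-Probability.Probability"
begin

text \<open>
  Functions on \<open>[0,1)\<close> are represented by functions on the whole real line that vanish outside
  \<open>[0,1)\<close>; a step function below is automatically of this kind, and two of them are at
  \<open>L\<^sub>2\<close> distance zero iff they are equal. Only the values \<open>a 1, \<dots>, a k\<close> and \<open>t 0, \<dots>, t k\<close> matter.
\<close>

definition step_fun :: "nat \<Rightarrow> (nat \<Rightarrow> real) \<Rightarrow> (nat \<Rightarrow> real) \<Rightarrow> real \<Rightarrow> real" where
  "step_fun k a t x = (\<Sum>j\<in>{1..k}. a j * indicator {t (j - 1)..<t j} x)"

definition partition01 :: "nat \<Rightarrow> (nat \<Rightarrow> real) \<Rightarrow> bool" where
  "partition01 k t \<longleftrightarrow> t 0 = 0 \<and> t k = 1 \<and> (\<forall>j\<in>{1..k}. t (j - 1) < t j)"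

definition Theta_k :: "real \<Rightarrow> real \<Rightarrow> nat \<Rightarrow> (real \<Rightarrow> real) set" where
  "Theta_k K \<delta> k = {step_fun k a t | a t. partition01 k t \<and>
     (\<forall>j\<in>{1..k}. \<bar>a j\<bar> \<le> K) \<and> (\<forall>j\<in>{1..k}. \<bar>t j - t (j - 1)\<bar> \<ge> \<delta>)}"

definition Theta :: "nat \<Rightarrow> real \<Rightarrow> real \<Rightarrow> (real \<Rightarrow> real) set" where
  "Theta kmax K \<delta> = (\<Union>k\<in>{1..kmax}. Theta_k K \<delta> k)"

text \<open>
  A ``number of change-points'' counts segments, so constants have exactly one. The classes
  \<^const>\<open>Theta_k\<close> are not disjoint (adjacent levels may coincide there); the number of change-points
  of a given function refers to a representation with distinct adjacent levels.
\<close>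

definition has_change_points :: "(real \<Rightarrow> real) \<Rightarrow> nat \<Rightarrow> bool" where
  "has_change_points \<theta> k \<longleftrightarrow> (\<exists>a t. partition01 k t \<and> (\<forall>j\<in>{1..<k}. a j \<noteq> a (j + 1)) \<and> \<theta> = step_fun k a t)"

definition L2_norm01 :: "(real \<Rightarrow> real) \<Rightarrow> real" where
  "L2_norm01 f = sqrt (LINT x:{0..<1}|lborel. (f x)\<^sup>2)"

definition L2_dist01 :: "(real \<Rightarrow> real) \<Rightarrow> (real \<Rightarrow> real) \<Rightarrow> real" where
  "L2_dist01 f g = L2_norm01 (\<lambda>x. f x - g x)"

text \<open>
  On arbitrary functions \<^const>\<open>L2_dist01\<close> is not a metric; it is one on \<^const>\<open>Theta\<close>, see
  \<open>Metric_space_Theta\<close> below. Priors are probability measures on the resulting Borel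
  \<open>\<sigma>\<close>-algebra.
\<close>

definition Theta_borel :: "nat \<Rightarrow> real \<Rightarrow> real \<Rightarrow> (real \<Rightarrow> real) measure" where
  "Theta_borel kmax K \<delta> = sigma (Theta kmax K \<delta>)
     {U. openin (Metric_space.mtopology (Theta kmax K \<delta>) L2_dist01) U}"

definition is_prior :: "nat \<Rightarrow> real \<Rightarrow> real \<Rightarrow> (real \<Rightarrow> real) measure \<Rightarrow> bool" where
  "is_prior kmax K \<delta> \<pi> \<longleftrightarrow> prob_space \<pi> \<and>
     space \<pi> = Theta kmax K \<delta> \<and> sets \<pi> = sets (Theta_borel kmax K \<delta>)"

definition obs_law :: "(real \<Rightarrow> real) \<Rightarrow> (real \<times> real) measure" where
  "obs_law \<theta> = distr (uniform_measure lborel {0..<1} \<Otimes>\<^sub>M density lborel std_normal_density)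
     (borel \<Otimes>\<^sub>M borel) (\<lambda>(x, e). (x, \<theta> x + e))"

definition obs_density :: "(real \<Rightarrow> real) \<Rightarrow> real \<times> real \<Rightarrow> real" where
  "obs_density \<theta> = (\<lambda>(x, y). indicator {0..<1} x * normal_density (\<theta> x) 1 y)"

text \<open>The observations \<open>Z\<^sub>1, \<dots>, Z\<^sub>n\<close> are indexed by \<open>0, \<dots>, n - 1\<close>.\<close>

definition sample_law :: "(real \<Rightarrow> real) \<Rightarrow> nat \<Rightarrow> (nat \<Rightarrow> real \<times> real) measure" where
  "sample_law \<theta> n = PiM {..<n} (\<lambda>_. obs_law \<theta>)"

definition likelihood :: "nat \<Rightarrow> (nat \<Rightarrow> real \<times> real) \<Rightarrow> (real \<Rightarrow> real) \<Rightarrow> real" where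
  "likelihood n z \<theta> = (\<Prod>i<n. obs_density \<theta> (z i))"

definition posterior ::
  "(real \<Rightarrow> real) measure \<Rightarrow> nat \<Rightarrow> (nat \<Rightarrow> real \<times> real) \<Rightarrow> (real \<Rightarrow> real) set \<Rightarrow> real" where
  "posterior \<pi> n z A = (LINT \<theta>:A|\<pi>. likelihood n z \<theta>) / (LINT \<theta>|\<pi>. likelihood n z \<theta>)"

definition model_consistent :: "nat \<Rightarrow> real \<Rightarrow> real \<Rightarrow> (real \<Rightarrow> real) measure \<Rightarrow> bool" where
  "model_consistent kmax K \<delta> \<pi> \<longleftrightarrow>
     (\<forall>\<theta>\<^sub>0\<in>Theta kmax K \<delta>. \<forall>k\<^sub>0. has_change_points \<theta>\<^sub>0 k\<^sub>0 \<longrightarrow>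
       (\<forall>\<eta>>0. (\<lambda>n. measure (sample_law \<theta>\<^sub>0 n)
           {z \<in> space (sample_law \<theta>\<^sub>0 n). \<bar>posterior \<pi> n z (Theta_k K \<delta> k\<^sub>0) - 1\<bar> > \<eta>})
         \<longlonglongrightarrow> 0))"

lemma step_fun_measurable [measurable]: "step_fun k a t \<in> borel_measurable borel"
proof -
  have "step_fun k a t = (\<lambda>x. \<Sum>j\<in>{1..k}. a j * indicator {t (j - 1)..<t j} x)"
    by (simp add: step_fun_def fun_eq_iff)
  also have "\<dots> \<in> borel_measurable borel" by measurable
  finally show ?thesis .
qed

lemma Theta_measurable: "\<theta> \<in> Theta kmax K \<delta> \<Longrightarrow> \<theta> \<in> borel_measurable borel"
  by (auto simp: Theta_def Theta_k_def)

lemma step_fun_bounded: "\<bar>step_fun k a t x\<bar> \<le> (\<Sum>j\<in>{1..k}. \<bar>a j\<bar>)"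
  unfolding step_fun_def
  by (intro order.trans[OF sum_abs] sum_mono) (auto simp: indicator_def)

lemma Theta_bounded: "\<theta> \<in> Theta kmax K \<delta> \<Longrightarrow> \<exists>B. \<forall>x. \<bar>\<theta> x\<bar> \<le> B"
  using step_fun_bounded by (fastforce simp: Theta_def Theta_k_def)

lemma partition01_bounds:
  assumes "partition01 k t" "j \<le> k" shows "0 \<le> t j" "t j \<le> 1"
proof -
  have step: "t i \<le> t (Suc i)" if "i < k" for i
    using assms(1) that unfolding partition01_def
    by (metis Suc_leI atLeastAtMost_iff diff_Suc_1 le_add1 less_imp_le plus_1_eq_Suc)
  have "i \<le> k \<Longrightarrow> 0 \<le> t i" for i
    by (induction i) (use assms(1) step in \<open>auto simp: partition01_def intro: order.trans\<close>)
  then show "0 \<le> t j" using assms(2) by blast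
  have "t (k - i) \<le> 1" for i
  proof (induction i)
    case 0
    then show ?case using assms(1) by (simp add: partition01_def)
  next
    case (Suc i)
    show ?case
    proof (cases "i < k")
      case True
      then have "t (k - Suc i) \<le> t (k - i)"
        using step[of "k - Suc i"] by (simp add: Suc_diff_Suc)
      with Suc show ?thesis by linarith
    qed (use Suc in simp)
  qed
  from this[of "k - j"] show "t j \<le> 1" using assms(2) by simp
qed

lemma Theta_vanishes:
  assumes "\<theta> \<in> Theta kmax K \<delta>" "x \<notin> {0..<1}" shows "\<theta> x = 0"
proof -
  obtain k a t where th: "\<theta> = step_fun k a t" and p: "partition01 k t"
    using assms(1) by (auto simp: Theta_def Theta_k_def)
  have "indicator {t (j - 1)..<t j} x = (0::real)" if "j \<in> {1..k}" for j
    using partition01_bounds(2)[OF p, of j] partition01_bounds(1)[OF p, of "j - 1"] that assms(2)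
    by (fastforce simp: indicator_def)
  then show ?thesis unfolding th step_fun_def by (intro sum.neutral) auto
qed

lemma Theta_right_constant:
  assumes "\<theta> \<in> Theta kmax K \<delta>" shows "\<forall>\<^sub>F y in at_right x. \<theta> y = \<theta> x"
proof -
  obtain k a t where th: "\<theta> = step_fun k a t"
    using assms(1) by (auto simp: Theta_def Theta_k_def)
  have ind: "\<forall>\<^sub>F y in at_right x. indicator {u..<v} y = (indicator {u..<v} x :: real)" for u v
  proof -
    consider "x < u" | "u \<le> x" "x < v" | "v \<le> x" by linarith
    then show ?thesis
    proof cases
      case 1
      then show ?thesis by (intro eventually_mono[OF eventually_at_right_real[OF 1]]) auto
    next
      case 2
      then show ?thesis by (intro eventually_mono[OF eventually_at_right_real[OF 2(2)]]) auto
    next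
      case 3
      show ?thesis
        by (intro eventually_mono[OF eventually_at_right_real[of x "x + 1"]]) (use 3 in auto)
    qed
  qed
  have "\<forall>\<^sub>F y in at_right x. \<forall>j\<in>{1..k}. indicator {t (j - 1)..<t j} y
      = (indicator {t (j - 1)..<t j} x :: real)"
    by (intro eventually_ball_finite) (auto intro: ind)
  then show ?thesis unfolding th step_fun_def by eventually_elim simp
qed

lemma set_integrable01_bounded:
  fixes f :: "real \<Rightarrow> real"
  assumes "f \<in> borel_measurable borel" "\<And>x. \<bar>f x\<bar> \<le> B"
  shows "set_integrable lborel {0..<1} f"
  unfolding set_integrable_def
proof (rule integrableI_bounded_set_indicator[where B = B])
  show "f \<in> borel_measurable lborel" using assms(1) by simp
qed (use assms(2) in auto)

lemma Theta_diff_square_integrable: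
  assumes "f \<in> Theta kmax K \<delta>" "g \<in> Theta kmax K \<delta>" "f' \<in> Theta kmax K \<delta>" "g' \<in> Theta kmax K \<delta>"
  shows "set_integrable lborel {0..<1} (\<lambda>x. (f x - g x) * (f' x - g' x))"
proof -
  have [measurable]: "f \<in> borel_measurable borel" "g \<in> borel_measurable borel"
    "f' \<in> borel_measurable borel" "g' \<in> borel_measurable borel"
    using assms by (auto dest: Theta_measurable)
  obtain B C D E where b: "\<And>x. \<bar>f x\<bar> \<le> B" "\<And>x. \<bar>g x\<bar> \<le> C" "\<And>x. \<bar>f' x\<bar> \<le> D" "\<And>x. \<bar>g' x\<bar> \<le> E"
    using assms[THEN Theta_bounded] by metis
  have "\<bar>(f x - g x) * (f' x - g' x)\<bar> \<le> (B + C) * (D + E)" for x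
    unfolding abs_mult
    by (intro mult_mono) (use b(1)[of x] b(2)[of x] b(3)[of x] b(4)[of x] in linarith)+
  then show ?thesis by (intro set_integrable01_bounded) auto
qed

lemma L2_dist01_triangle:
  assumes "f \<in> Theta kmax K \<delta>" "g \<in> Theta kmax K \<delta>" "h \<in> Theta kmax K \<delta>"
  shows "L2_dist01 f h \<le> L2_dist01 f g + L2_dist01 g h"
proof -
  let ?I = "\<lambda>u. LINT x:{0..<1}|lborel. (u x :: real)"
  define p where "p = (\<lambda>x. f x - g x)"
  define q where "q = (\<lambda>x. g x - h x)"
  have ii: "set_integrable lborel {0..<1} (\<lambda>x. p x * p x)"
    "set_integrable lborel {0..<1} (\<lambda>x. q x * q x)"
    "set_integrable lborel {0..<1} (\<lambda>x. p x * q x)"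
    unfolding p_def q_def using assms by (auto intro!: Theta_diff_square_integrable)
  define A where "A = ?I (\<lambda>x. p x * p x)"
  define B where "B = ?I (\<lambda>x. q x * q x)"
  define C where "C = ?I (\<lambda>x. p x * q x)"
  have quad: "?I (\<lambda>x. (s * p x + r * q x)\<^sup>2) = s\<^sup>2 * A + 2 * s * r * C + r\<^sup>2 * B" for s r
  proof -
    have "?I (\<lambda>x. (s * p x + r * q x)\<^sup>2) =
        ?I (\<lambda>x. s\<^sup>2 * (p x * p x) + 2 * s * r * (p x * q x) + r\<^sup>2 * (q x * q x))"
      by (intro arg_cong[where f = ?I]) (auto simp: power2_eq_square algebra_simps)
    also have "\<dots> = s\<^sup>2 * A + 2 * s * r * C + r\<^sup>2 * B"
      unfolding A_def B_def C_def using ii by (simp add: set_integral_add)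
    finally show ?thesis .
  qed
  have nn: "?I (\<lambda>x. (s * p x + r * q x)\<^sup>2) \<ge> 0" for s r
    unfolding set_lebesgue_integral_def by (intro integral_nonneg_AE) auto
  have A0: "A \<ge> 0" and B0: "B \<ge> 0" using nn[of 1 0] nn[of 0 1] unfolding quad by auto
  have CS: "C \<le> sqrt A * sqrt B"
  proof -
    define s where "s = sqrt B"
    define r where "r = sqrt A"
    have "s\<^sup>2 * r\<^sup>2 + 2 * s * (-r) * C + (-r)\<^sup>2 * s\<^sup>2 \<ge> 0"
      using nn[of s "-r"] A0 B0 unfolding quad by (simp add: s_def r_def)
    then have le: "s * r * C \<le> s * r * (s * r)" by (simp add: power2_eq_square algebra_simps)
    have s0: "s \<ge> 0" and r0: "r \<ge> 0" using A0 B0 by (auto simp: s_def r_def)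
    show ?thesis
    proof (cases "s * r = 0")
      case False
      then have "s * r > 0" using s0 r0 by (simp add: less_le)
      with le have "C \<le> s * r" by (simp only: mult_le_cancel_left_pos)
      then show ?thesis by (simp add: s_def r_def mult.commute)
    next
      case True
      then consider "A = 0" | "B = 0" using A0 B0 by (auto simp: s_def r_def)
      then have "C \<le> 0"
      proof cases
        case 1
        show ?thesis
        proof (rule ccontr)
          assume "\<not> C \<le> 0"
          then have "0 \<le> (- (B + 1) / C) * 2 * C + B" using nn[of "- (B + 1) / C" 1] 1 unfolding quad
            by simp
          then show False using \<open>\<not> C \<le> 0\<close> B0 by simp
        qed
      next
        case 2
        show ?thesis
        proof (rule ccontr)
          assume "\<not> C \<le> 0"
          then have "0 \<le> (- (A + 1) / C) * 2 * C + A" using nn[of 1 "- (A + 1) / C"] 2 unfolding quad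
            by simp
          then show False using \<open>\<not> C \<le> 0\<close> A0 by simp
        qed
      qed
      then show ?thesis using A0 B0 by (meson mult_nonneg_nonneg order.trans real_sqrt_ge_zero)
    qed
  qed
  have "A + 2 * C + B \<le> (sqrt A + sqrt B)\<^sup>2"
    using CS A0 B0 by (simp add: power2_sum)
  then have "sqrt (A + 2 * C + B) \<le> sqrt A + sqrt B"
    using A0 B0 by (intro real_le_lsqrt) auto
  moreover have "L2_dist01 f h = sqrt (A + 2 * C + B)"
    using quad[of 1 1] unfolding L2_dist01_def L2_norm01_def p_def q_def by simp
  moreover have "L2_dist01 f g = sqrt A" "L2_dist01 g h = sqrt B"
    unfolding L2_dist01_def L2_norm01_def A_def B_def p_def q_def by (simp_all add: power2_eq_square)
  ultimately show ?thesis by simp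
qed

lemma L2_dist01_eq_0_imp:
  assumes f: "f \<in> Theta kmax K \<delta>" and g: "g \<in> Theta kmax K \<delta>" and "L2_dist01 f g = 0"
  shows "f = g"
proof
  fix x
  have "(LINT x|lborel. indicator {0..<1} x * (f x - g x)\<^sup>2) = 0"
    using assms(3) unfolding L2_dist01_def L2_norm01_def set_lebesgue_integral_def by simp
  moreover have "integrable lborel (\<lambda>x. indicator {0..<1} x * (f x - g x)\<^sup>2)"
    using Theta_diff_square_integrable[OF f g f g]
    by (simp add: set_integrable_def power2_eq_square)
  ultimately have "AE y in lborel. indicator {0..<1} y * (f y - g y)\<^sup>2 = 0"
    by (subst (asm) integral_nonneg_eq_0_iff_AE) auto
  then have ae: "AE y in lborel. y \<in> {0..<1} \<longrightarrow> f y = g y"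
    by eventually_elim (auto simp: indicator_def)
  show "f x = g x"
  proof (cases "x \<in> {0..<1}")
    case False
    then show ?thesis using Theta_vanishes[OF f] Theta_vanishes[OF g] by simp
  next
    case True
    have "\<forall>\<^sub>F y in at_right x. f y = f x \<and> g y = g x \<and> y \<in> {x<..<1}"
      using Theta_right_constant[OF f] Theta_right_constant[OF g] eventually_at_right_real[of x 1] True
      by (auto intro!: eventually_conj)
    then obtain b where b: "b > x" "\<And>y. x < y \<Longrightarrow> y < b \<Longrightarrow> f y = f x \<and> g y = g x \<and> y < 1"
      by (auto simp: eventually_at_right_field)
    show ?thesis
    proof (rule ccontr)
      assume "f x \<noteq> g x"
      have "AE y in lborel. y \<notin> {x<..<b}"
        using ae
      proof (rule AE_mp, intro AE_I2 impI notI)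
        fix y assume "y \<in> {0..<1} \<longrightarrow> f y = g y" "y \<in> {x<..<b}"
        with b(2)[of y] True \<open>f x \<noteq> g x\<close> show False by simp
      qed
      then have "emeasure lborel {x<..<b} = 0"
        by (subst (asm) AE_iff_measurable[of "{x<..<b}"]) auto
      with b(1) show False by simp
    qed
  qed
qed

lemma Metric_space_Theta: "Metric_space (Theta kmax K \<delta>) L2_dist01"
proof
  show "0 \<le> L2_dist01 f g" for f g
    unfolding L2_dist01_def L2_norm01_def set_lebesgue_integral_def
    by (intro real_sqrt_ge_zero integral_nonneg_AE) auto
  show "L2_dist01 f g = L2_dist01 g f" for f g
    unfolding L2_dist01_def L2_norm01_def by (simp add: power2_commute)
  show "L2_dist01 f g = 0 \<longleftrightarrow> f = g" if "f \<in> Theta kmax K \<delta>" "g \<in> Theta kmax K \<delta>" for f g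
    using L2_dist01_eq_0_imp[OF that] by (auto simp: L2_dist01_def L2_norm01_def)
qed (rule L2_dist01_triangle)

lemma obs_law_eq_density:
  assumes [measurable]: "\<theta> \<in> borel_measurable borel"
  shows "obs_law \<theta> = density (lborel \<Otimes>\<^sub>M lborel) (\<lambda>z. ennreal (obs_density \<theta> z))"
proof (rule measure_eqI)
  show "sets (obs_law \<theta>) = sets (density (lborel \<Otimes>\<^sub>M lborel) (\<lambda>z. ennreal (obs_density \<theta> z)))"
    by (simp add: obs_law_def cong: sets_pair_measure_cong)
next
  fix A assume "A \<in> sets (obs_law \<theta>)"
  then have [measurable]: "A \<in> sets (borel \<Otimes>\<^sub>M borel)" by (simp add: obs_law_def)
  interpret N: prob_space "density lborel std_normal_density"
    by (rule prob_space_normal_density) simp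
  let ?U = "uniform_measure lborel {0..<1::real}" and ?N = "density lborel std_normal_density"
  have U: "?U = density lborel (indicator {0..<1})"
    by (simp add: uniform_measure_def divide_ennreal_def)
  have dm [measurable]: "obs_density \<theta> \<in> borel_measurable (borel \<Otimes>\<^sub>M borel)"
    unfolding obs_density_def normal_density_def by measurable
  have "emeasure (obs_law \<theta>) A = (\<integral>\<^sup>+z. indicator A z \<partial>obs_law \<theta>)"
    by (simp add: obs_law_def)
  also have "\<dots> = (\<integral>\<^sup>+z. indicator A (fst z, \<theta> (fst z) + snd z) \<partial>(?U \<Otimes>\<^sub>M ?N))"
    unfolding obs_law_def by (subst nn_integral_distr) (auto simp: case_prod_beta)
  also have "\<dots> = (\<integral>\<^sup>+x. \<integral>\<^sup>+e. indicator A (x, \<theta> x + e) \<partial>?N \<partial>?U)"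
    by (subst N.nn_integral_fst[symmetric]) auto
  also have "\<dots> = (\<integral>\<^sup>+x. indicator {0..<1} x *
      (\<integral>\<^sup>+e. ennreal (std_normal_density e) * indicator A (x, \<theta> x + e) \<partial>lborel) \<partial>lborel)"
    unfolding U by (simp add: nn_integral_density)
  also have "\<dots> = (\<integral>\<^sup>+x. indicator {0..<1} x *
      (\<integral>\<^sup>+y. ennreal (normal_density (\<theta> x) 1 y) * indicator A (x, y) \<partial>lborel) \<partial>lborel)"
  proof (rule nn_integral_cong, rule arg_cong2[where f = "(*)", OF refl])
    fix x :: real
    have "(\<integral>\<^sup>+y. ennreal (normal_density (\<theta> x) 1 y) * indicator A (x, y) \<partial>lborel)
        = (\<integral>\<^sup>+y. ennreal (normal_density (\<theta> x) 1 y) * indicator A (x, y) \<partial>distr lborel borel ((+) (\<theta> x)))"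
      by (simp add: lborel_distr_plus)
    also have "\<dots> = (\<integral>\<^sup>+e. ennreal (std_normal_density e) * indicator A (x, \<theta> x + e) \<partial>lborel)"
      by (subst nn_integral_distr) (auto simp: normal_density_def)
    finally show "(\<integral>\<^sup>+e. ennreal (std_normal_density e) * indicator A (x, \<theta> x + e) \<partial>lborel)
        = (\<integral>\<^sup>+y. ennreal (normal_density (\<theta> x) 1 y) * indicator A (x, y) \<partial>lborel)" by simp
  qed
  also have "\<dots> = (\<integral>\<^sup>+x. \<integral>\<^sup>+y. ennreal (obs_density \<theta> (x, y)) * indicator A (x, y) \<partial>lborel \<partial>lborel)"
    by (intro nn_integral_cong) (auto simp: obs_density_def indicator_def)
  also have "\<dots> = (\<integral>\<^sup>+z. ennreal (obs_density \<theta> z) * indicator A z \<partial>(lborel \<Otimes>\<^sub>M lborel))"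
    by (subst lborel.nn_integral_fst[symmetric]) auto
  also have "\<dots> = emeasure (density (lborel \<Otimes>\<^sub>M lborel) (\<lambda>z. ennreal (obs_density \<theta> z))) A"
    by (subst emeasure_density) auto
  finally show "emeasure (obs_law \<theta>) A
      = emeasure (density (lborel \<Otimes>\<^sub>M lborel) (\<lambda>z. ennreal (obs_density \<theta> z))) A" .
qed

end

theory Submission
  imports Defs "HOL-Real_Asymp.Real_Asymp"
begin

text \<open>
  Compare the true function \<open>0\<close> with \<open>\<theta>\<^sub>n = b\<^sub>n 1\<^bsub>[1/2,1)\<^esub>\<close>. Under \<open>0\<close>, consistency makes the
  posterior concentrate on the constants: \<open>e\<^sub>n = E\<^sub>0 (1 - \<Pi>\<^sup>n(k = 1)) \<rightarrow> 0\<close>. The likelihood ratio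
  \<open>L\<close> of \<open>n\<close> observations satisfies \<open>E\<^sub>0 L\<^sup>2 \<le> exp (n b\<^sub>n\<^sup>2)\<close>, so if \<open>n b\<^sub>n\<^sup>2\<close> is a small multiple of
  \<open>ln (1 / e\<^sub>n)\<close>, which still tends to infinity, the posterior also concentrates on the constants
  under \<open>\<theta>\<^sub>n\<close>. But every constant has distance at least \<open>b\<^sub>n / 2\<close> from \<open>\<theta>\<^sub>n\<close>, and
  \<open>\<surd>n b\<^sub>n \<rightarrow> \<infinity>\<close>.
\<close>

section \<open>The constants, the half steps and the distance between them\<close>

lemma Theta_1_eq:
  assumes "\<delta> \<le> 1"
  shows "Theta_k K \<delta> 1 = {\<lambda>x. c * indicator {0..<1} x | c. \<bar>c\<bar> \<le> K}"
proof (intro equalityI subsetI)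
  fix \<theta> assume "\<theta> \<in> Theta_k K \<delta> 1"
  then obtain a t where "\<theta> = step_fun 1 a t" "partition01 1 t" "\<bar>a 1\<bar> \<le> K"
    by (auto simp: Theta_k_def)
  then show "\<theta> \<in> {\<lambda>x. c * indicator {0..<1} x | c. \<bar>c\<bar> \<le> K}"
    by (auto simp: partition01_def step_fun_def fun_eq_iff indicator_def intro!: exI[of _ "a 1"])
next
  fix \<theta> :: "real \<Rightarrow> real" assume "\<theta> \<in> {\<lambda>x. c * indicator {0..<1} x | c. \<bar>c\<bar> \<le> K}"
  then obtain c where c: "\<theta> = (\<lambda>x. c * indicator {0..<1} x)" "\<bar>c\<bar> \<le> K" by auto
  \<comment> \<open>The embedding \<open>real\<close> serves as the breakpoint sequence: it sends 0
    to 0 and 1 to 1.\<close>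
  have "\<theta> = step_fun 1 (\<lambda>_. c) real" by (simp add: c step_fun_def fun_eq_iff)
  then show "\<theta> \<in> Theta_k K \<delta> 1"
    using c assms unfolding Theta_k_def mem_Collect_eq
    by (intro exI[of _ "\<lambda>_. c"] exI[of _ real]) (auto simp: partition01_def)
qed

lemma half_step_in_Theta:
  assumes "kmax \<ge> 2" "\<delta> \<le> 1 / 2" "\<bar>b\<bar> \<le> K"
  shows "(\<lambda>x. b * indicator {1 / 2..<1} x) \<in> Theta kmax K \<delta>"
proof -
  \<comment> \<open>Two segments of length 1/2 with levels 0 and \<open>b\<close>. Since
    \<open>Theta_k\<close> lets adjacent levels coincide, \<open>b = 0\<close> is allowed and puts
    the zero function into \<open>Theta\<close>.\<close>
  define a where "a = (\<lambda>j::nat. if j = 2 then b else 0)"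
  define t where "t = (\<lambda>j::nat. real j / 2)"
  have s: "{1..2} = {1, 2::nat}" by auto
  have "(\<lambda>x. b * indicator {1 / 2..<1} x) = step_fun 2 a t"
    by (simp add: step_fun_def s a_def t_def fun_eq_iff)
  moreover have "partition01 2 t" by (auto simp: partition01_def t_def s)
  moreover have "\<forall>j\<in>{1..2}. \<bar>a j\<bar> \<le> K" "\<forall>j\<in>{1..2}. \<bar>t j - t (j - 1)\<bar> \<ge> \<delta>"
    using assms unfolding s by (auto simp: a_def t_def)
  ultimately have "(\<lambda>x. b * indicator {1 / 2..<1} x) \<in> Theta_k K \<delta> 2"
    unfolding Theta_k_def by blast
  then show ?thesis using assms(1) by (auto simp: Theta_def)
qed

lemma zero_in_Theta:
  assumes "K > 0" "kmax \<ge> 2" "\<delta> \<le> 1 / 2"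
  shows "(\<lambda>_. 0) \<in> Theta kmax K \<delta>"
  using half_step_in_Theta[of kmax \<delta> 0 K] assms by simp

text \<open>Identifies the class \<open>Theta_k K \<delta> 1\<close> as the one on which consistency
  concentrates the posterior when the truth is zero.\<close>

lemma zero_has_change_points: "has_change_points (\<lambda>_. 0) 1"
  unfolding has_change_points_def
  by (rule exI[of _ "\<lambda>_. 0"], rule exI[of _ real]) (auto simp: partition01_def step_fun_def)

text \<open>The best constant approximation of the half step is its mean \<open>b / 2\<close>, which
  is off by \<open>\<bar>b\<bar> / 2\<close> at every point of [0,1).\<close>

lemma L2_dist_const_half_step:
  "\<bar>b\<bar> / 2 \<le> L2_norm01 (\<lambda>x. c * indicator {0..<1} x - b * indicator {1 / 2..<1} x)"
proof -
  have "(LINT x:{0..<1::real}|lborel. (c * indicator {0..<1} x - b * indicator {1 / 2..<1} x)\<^sup>2)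
      = (LINT x|lborel. c\<^sup>2 * indicator {0..<1/2} x + (c - b)\<^sup>2 * indicator {1/2..<1::real} x)"
    unfolding set_lebesgue_integral_def by (intro Bochner_Integration.integral_cong) (auto simp: indicator_def)
  also have "\<dots> = (c\<^sup>2 + (c - b)\<^sup>2) / 2"
    by (subst Bochner_Integration.integral_add)
      (auto simp: field_simps less_top[symmetric])
  \<comment> \<open>Completing the square in \<open>c\<close> separates the minimum from the
    excess.\<close>
  also have "\<dots> = (b / 2)\<^sup>2 + (c - b / 2)\<^sup>2"
    by (simp add: power2_eq_square field_simps)
  finally show ?thesis
    unfolding L2_norm01_def by (intro real_le_rsqrt) (simp add: power_divide)
qed

section \<open>Measurability of the posterior\<close>

lemma openin_Theta_borel:
  assumes "sets \<pi> = sets (Theta_borel kmax K \<delta>)"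
    and "openin (Metric_space.mtopology (Theta kmax K \<delta>) L2_dist01) U"
  shows "U \<in> sets \<pi>"
proof -
  interpret Metric_space "Theta kmax K \<delta>" L2_dist01 by (rule Metric_space_Theta)
  have "{U. openin mtopology U} \<subseteq> Pow (Theta kmax K \<delta>)"
    using openin_subset[of mtopology] by auto
  then show ?thesis using assms by (simp add: Theta_borel_def)
qed

text \<open>The set is open: by the triangle inequality, the ball around a member whose radius is
  the surplus of its distance over \<open>r\<close> stays inside.\<close>

lemma far_set_measurable:
  assumes "sets \<pi> = sets (Theta_borel kmax K \<delta>)" and g: "g \<in> Theta kmax K \<delta>"
  shows "{\<theta> \<in> Theta kmax K \<delta>. L2_norm01 (\<lambda>x. \<theta> x - g x) > r} \<in> sets \<pi>"
proof (rule openin_Theta_borel[OF assms(1)])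
  interpret Metric_space "Theta kmax K \<delta>" L2_dist01 by (rule Metric_space_Theta)
  have "\<exists>\<epsilon>>0. mball \<theta> \<epsilon> \<subseteq> {\<theta> \<in> Theta kmax K \<delta>. r < L2_dist01 \<theta> g}"
    if "\<theta> \<in> Theta kmax K \<delta>" "r < L2_dist01 \<theta> g" for \<theta>
  proof (intro exI[of _ "L2_dist01 \<theta> g - r"] conjI subsetI)
    fix h assume "h \<in> mball \<theta> (L2_dist01 \<theta> g - r)"
    then show "h \<in> {\<theta> \<in> Theta kmax K \<delta>. r < L2_dist01 \<theta> g}"
      using triangle[of \<theta> h g] g by auto
  qed (use that in auto)
  then have "openin mtopology {\<theta> \<in> Theta kmax K \<delta>. r < L2_dist01 \<theta> g}"
    unfolding openin_mtopology by auto
  then show "openin mtopology {\<theta> \<in> Theta kmax K \<delta>. r < L2_norm01 (\<lambda>x. \<theta> x - g x)}"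
    by (simp add: L2_dist01_def)
qed

text \<open>
  Evaluation at a point is not continuous for the \<open>L\<^sub>2\<close> distance. It is nevertheless Borel: by
  right-continuity it is a limit of averages over shrinking intervals, which are continuous.
\<close>

lemma integral_functional_measurable:
  assumes sp: "space \<pi> = Theta kmax K \<delta>" and se: "sets \<pi> = sets (Theta_borel kmax K \<delta>)"
    and S: "S \<in> sets borel" "S \<subseteq> {0..<1}"
  shows "(\<lambda>\<theta>. LINT x:S|lborel. \<theta> x) \<in> borel_measurable \<pi>"
  unfolding borel_measurable_iff_greater sp
proof (intro allI openin_Theta_borel[OF se])
  fix c
  interpret Metric_space "Theta kmax K \<delta>" L2_dist01 by (rule Metric_space_Theta)
  let ?U = "{\<theta> \<in> Theta kmax K \<delta>. c < (LINT x:S|lborel. \<theta> x)}"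
  have int: "set_integrable lborel S \<theta>" if "\<theta> \<in> Theta kmax K \<delta>" for \<theta>
  proof (rule set_integrable_subset[where A = "{0..<1}"])
    from Theta_bounded[OF that] obtain B where "\<And>x. \<bar>\<theta> x\<bar> \<le> B" by auto
    then show "set_integrable lborel {0..<1} \<theta>"
      using Theta_measurable[OF that] by (intro set_integrable01_bounded)
  qed (use S in auto)
  have "\<exists>\<epsilon>>0. mball \<theta> \<epsilon> \<subseteq> ?U" if th: "\<theta> \<in> ?U" for \<theta>
  proof -
    \<comment> \<open>The slack above \<open>c\<close> serves as the radius: on a set of measure at
      most 1 the integral is 1-Lipschitz for the L2 distance.\<close>
    define \<epsilon> where "\<epsilon> = (LINT x:S|lborel. \<theta> x) - c"
    have \<epsilon>: "\<epsilon> > 0" using th by (simp add: \<epsilon>_def)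
    have "h \<in> ?U" if "h \<in> mball \<theta> \<epsilon>" for h
    proof -
      have T: "\<theta> \<in> Theta kmax K \<delta>" "h \<in> Theta kmax K \<delta>" and d: "L2_dist01 \<theta> h < \<epsilon>"
        using that by auto
      let ?q = "LINT x:{0..<1}|lborel. (\<theta> x - h x)\<^sup>2"
      have q: "set_integrable lborel {0..<1} (\<lambda>x. (\<theta> x - h x)\<^sup>2)"
        using Theta_diff_square_integrable[OF T T] by (simp add: power2_eq_square)
      have one: "set_integrable lborel {0..<1} (\<lambda>x::real. \<epsilon> / 2)"
        by (intro set_integrable01_bounded[where B = "\<epsilon> / 2"]) (use \<epsilon> in auto)
      have "?q < \<epsilon>\<^sup>2"
      proof -
        have "sqrt ?q < sqrt (\<epsilon>\<^sup>2)" using d \<epsilon> by (simp add: L2_dist01_def L2_norm01_def)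
        then show ?thesis by (simp only: real_sqrt_less_iff)
      qed
      have "(LINT x:S|lborel. \<theta> x) - (LINT x:S|lborel. h x) = (LINT x:S|lborel. \<theta> x - h x)"
        using int T by (simp add: set_integral_diff)
      \<comment> \<open>The pointwise bound
        \<open>u \<le> \<epsilon> / 2 + u^2 / (2 * \<epsilon>)\<close> replaces Cauchy-Schwarz. Its
        right side is nonnegative, so the integral may be enlarged from \<open>S\<close> to
        [0,1).\<close>
      also have "\<dots> \<le> (LINT x:{0..<1}|lborel. \<epsilon> / 2 + (1 / (2 * \<epsilon>)) * (\<theta> x - h x)\<^sup>2)"
        unfolding set_lebesgue_integral_def
      proof (rule integral_mono)
        show "integrable lborel (\<lambda>x. indicator S x *\<^sub>R (\<theta> x - h x))"
          using set_integral_diff(1)[OF int int] T by (simp add: set_integrable_def)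
        show "integrable lborel (\<lambda>x. indicator {0..<1} x *\<^sub>R (\<epsilon> / 2 + 1 / (2 * \<epsilon>) * (\<theta> x - h x)\<^sup>2))"
          using set_integral_add(1)[OF one set_integrable_mult_right[of "1 / (2 * \<epsilon>)", OF q]]
          by (simp add: set_integrable_def)
        fix x
        let ?u = "\<theta> x - h x"
        have "0 \<le> (\<epsilon> - ?u)\<^sup>2 / (2 * \<epsilon>)" using \<epsilon> by simp
        also have "\<dots> = \<epsilon> / 2 + 1 / (2 * \<epsilon>) * ?u\<^sup>2 - ?u"
          using \<epsilon> by (simp add: power2_eq_square field_simps)
        finally have "?u \<le> \<epsilon> / 2 + 1 / (2 * \<epsilon>) * ?u\<^sup>2" by simp
        moreover have "0 \<le> \<epsilon> / 2 + 1 / (2 * \<epsilon>) * ?u\<^sup>2" using \<epsilon> by simp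
        ultimately show "indicator S x *\<^sub>R ?u \<le> indicator {0..<1} x *\<^sub>R (\<epsilon> / 2 + 1 / (2 * \<epsilon>) * ?u\<^sup>2)"
          using S by (auto simp: indicator_def)
      qed
      also have "\<dots> = \<epsilon> / 2 + 1 / (2 * \<epsilon>) * ?q"
        using one q by (simp add: set_integral_add) (simp add: set_lebesgue_integral_def)
      also have "\<dots> < \<epsilon> / 2 + 1 / (2 * \<epsilon>) * \<epsilon>\<^sup>2"
        using \<open>?q < \<epsilon>\<^sup>2\<close> \<epsilon> by (simp add: divide_strict_right_mono)
      also have "\<dots> = \<epsilon>" using \<epsilon> by (simp add: power2_eq_square)
      finally show ?thesis using T by (simp add: \<epsilon>_def)
    qed
    then show ?thesis using \<epsilon> by blast
  qed
  then show "openin mtopology ?U" unfolding openin_mtopology by auto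
qed

lemma Theta_eval_measurable:
  assumes sp: "space \<pi> = Theta kmax K \<delta>" and se: "sets \<pi> = sets (Theta_borel kmax K \<delta>)"
  shows "(\<lambda>\<theta>. \<theta> q) \<in> borel_measurable \<pi>"
proof (cases "q \<in> {0..<1}")
  case False
  then have "\<theta> q = 0" if "\<theta> \<in> space \<pi>" for \<theta> using Theta_vanishes[of \<theta>] that sp by blast
  then show ?thesis by (subst measurable_cong[where g = "\<lambda>_. 0"]) auto
next
  case True
  \<comment> \<open>Widths at most \<open>1 - q\<close> keep the averaging intervals inside
    [0,1).\<close>
  define h where "h m = (1 - q) / real (Suc m)" for m
  have h: "h m > 0" "q + h m \<le> 1" for m
  proof -
    show "h m > 0" using True by (simp add: h_def)
    have "h m \<le> 1 - q" unfolding h_def using True by (simp add: divide_le_eq mult_le_cancel_left1)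
    then show "q + h m \<le> 1" by simp
  qed
  have h0: "h \<longlonglongrightarrow> 0" unfolding h_def by real_asymp
  show ?thesis
  proof (rule borel_measurable_LIMSEQ_metric)
    show "(\<lambda>\<theta>. (LINT x:{q..<q + h m}|lborel. \<theta> x) / h m) \<in> borel_measurable \<pi>" for m
      using h[of m] True by (intro borel_measurable_divide integral_functional_measurable[OF sp se]) auto
    fix \<theta> assume "\<theta> \<in> space \<pi>"
    then have "\<forall>\<^sub>F y in at_right q. \<theta> y = \<theta> q" using Theta_right_constant sp by auto
    then obtain b where b: "b > q" "\<And>y. q < y \<Longrightarrow> y < b \<Longrightarrow> \<theta> y = \<theta> q"
      by (auto simp: eventually_at_right_field)
    have "\<forall>\<^sub>F m in sequentially. h m < b - q"
      using h0 b(1) by (intro order_tendstoD) auto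
    then have "\<forall>\<^sub>F m in sequentially. (LINT x:{q..<q + h m}|lborel. \<theta> x) / h m = \<theta> q"
    proof eventually_elim
      case (elim m)
      \<comment> \<open>Once the interval lies where \<theta> is constant to the right of
        \<open>q\<close>, the average is exactly \<open>\<theta> q\<close>.\<close>
      have "(LINT x:{q..<q + h m}|lborel. \<theta> x) = (LINT x:{q..<q + h m}|lborel. \<theta> q)"
      proof (rule set_lebesgue_integral_cong)
        have "\<theta> x = \<theta> q" if "x \<in> {q..<q + h m}" for x
          using b(2)[of x] elim that by (cases "x = q") auto
        then show "\<forall>x. x \<in> {q..<q + h m} \<longrightarrow> \<theta> x = \<theta> q" by blast
      qed auto
      also have "\<dots> = \<theta> q * h m" using h[of m] by (simp add: set_lebesgue_integral_def)
      finally show ?case using h[of m] by simp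
    qed
    then show "(\<lambda>m. (LINT x:{q..<q + h m}|lborel. \<theta> x) / h m) \<longlonglongrightarrow> \<theta> q"
      by (rule tendsto_eventually)
  qed
qed

text \<open>Round \<open>x\<close> up to a grid of mesh \<open>1 / Suc m\<close>. Evaluation at the
  rounded point splits into countably many evaluations at fixed points, and right-constancy recovers
  \<open>\<theta> x\<close> in the limit.\<close>

lemma Theta_joint_eval_measurable:
  assumes sp: "space \<pi> = Theta kmax K \<delta>" and se: "sets \<pi> = sets (Theta_borel kmax K \<delta>)"
  shows "(\<lambda>(x, \<theta>). \<theta> x) \<in> borel_measurable (borel \<Otimes>\<^sub>M \<pi>)"
proof (rule borel_measurable_LIMSEQ_metric)
  \<comment> \<open>Floor plus one, not ceiling: the grid point must lie strictly to the right of
    \<open>x\<close> for the limit to run along \<open>at_right x\<close>.\<close>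
  define r where "r m x = (of_int \<lfloor>real (Suc m) * x\<rfloor> + 1) / real (Suc m)" for m and x :: real
  note ev [measurable] = Theta_eval_measurable[OF sp se]
  show "(\<lambda>(x, \<theta>). \<theta> (r m x)) \<in> borel_measurable (borel \<Otimes>\<^sub>M \<pi>)" for m
    unfolding case_prod_beta r_def
    by (rule measurable_compose_countable[where f = "\<lambda>i p. snd p ((of_int i + 1) / real (Suc m))"
          and g = "\<lambda>p. \<lfloor>real (Suc m) * fst p\<rfloor>"]) measurable
  fix p :: "real \<times> (real \<Rightarrow> real)" assume "p \<in> space (borel \<Otimes>\<^sub>M \<pi>)"
  then obtain x \<theta> where p: "p = (x, \<theta>)" "\<theta> \<in> Theta kmax K \<delta>"
    by (auto simp: space_pair_measure sp)
  have gt: "r m x > x" and le: "r m x \<le> x + 1 / real (Suc m)" for m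
  proof -
    let ?s = "real (Suc m)"
    have "?s * x < of_int \<lfloor>?s * x\<rfloor> + 1" "of_int \<lfloor>?s * x\<rfloor> \<le> ?s * x" by linarith+
    then show "r m x > x" "r m x \<le> x + 1 / ?s"
      unfolding r_def by (simp_all add: field_simps del: of_nat_Suc)
  qed
  have "(\<lambda>m. r m x) \<longlonglongrightarrow> x"
  proof (rule tendsto_sandwich[where f = "\<lambda>_. x" and h = "\<lambda>m. x + 1 / real (Suc m)"])
    show "(\<lambda>m. x + 1 / real (Suc m)) \<longlonglongrightarrow> x" by real_asymp
  qed (use gt le in \<open>auto intro: less_imp_le always_eventually\<close>)
  then have "filterlim (\<lambda>m. r m x) (at_right x) sequentially"
    using less_imp_neq[OF gt, THEN not_sym] gt by (simp add: filterlim_at)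
  then have "\<forall>\<^sub>F m in sequentially. \<theta> (r m x) = \<theta> x"
    using Theta_right_constant[OF p(2), of x] by (auto simp: filterlim_iff)
  then show "(\<lambda>m. case p of (x, \<theta>) \<Rightarrow> \<theta> (r m x)) \<longlonglongrightarrow> (case p of (x, \<theta>) \<Rightarrow> \<theta> x)"
    by (auto simp: p intro: tendsto_eventually)
qed

text \<open>A step function is constant just to the right of each point, so constancy on [0,1) can
  be tested at the rationals, which gives countably many measurable conditions.\<close>

lemma Theta_1_measurable:
  assumes sp: "space \<pi> = Theta kmax K \<delta>" and se: "sets \<pi> = sets (Theta_borel kmax K \<delta>)"
    and "kmax \<ge> 1" "\<delta> \<le> 1"
  shows "Theta_k K \<delta> 1 \<in> sets \<pi>"
proof -
  note [measurable] = Theta_eval_measurable[OF sp se]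
  have sub: "Theta_k K \<delta> 1 \<subseteq> Theta kmax K \<delta>" using assms(3) by (auto simp: Theta_def)
  have "Theta_k K \<delta> 1 = {\<theta> \<in> space \<pi>. \<bar>\<theta> 0\<bar> \<le> K} \<inter> {\<theta> \<in> space \<pi>. \<forall>q\<in>\<rat>\<inter>{0..<1}. \<theta> q = \<theta> 0}"
    (is "_ = ?R")
  proof (intro equalityI subsetI)
    fix \<theta> assume "\<theta> \<in> Theta_k K \<delta> 1"
    then show "\<theta> \<in> ?R"
      using sub sp unfolding Theta_1_eq[OF assms(4)] by auto
  next
    fix \<theta> assume "\<theta> \<in> ?R"
    then have T: "\<theta> \<in> Theta kmax K \<delta>" and K: "\<bar>\<theta> 0\<bar> \<le> K"
      and q: "\<forall>q\<in>\<rat>\<inter>{0..<1}. \<theta> q = \<theta> 0" unfolding sp by blast+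
    have "\<theta> x = \<theta> 0 * indicator {0..<1} x" for x
    proof (cases "x \<in> {0..<1}")
      case True
      have "\<forall>\<^sub>F y in at_right x. \<theta> y = \<theta> x \<and> y \<in> {x<..<1}"
        using Theta_right_constant[OF T] eventually_at_right_real[of x 1] True
        by (auto intro!: eventually_conj)
      then obtain b where b: "b > x" "\<And>y. x < y \<Longrightarrow> y < b \<Longrightarrow> \<theta> y = \<theta> x \<and> y < 1"
        by (auto simp: eventually_at_right_field)
      obtain y where y: "y \<in> \<rat>" "x < y" "y < b" using Rats_dense_in_real[OF b(1)] by auto
      then have "\<theta> y = \<theta> x" "y < 1" using b(2) by auto
      moreover from this have "\<theta> y = \<theta> 0" using y True by (intro bspec[OF q]) simp
      ultimately show ?thesis using True by simp
    qed (use Theta_vanishes[OF T] in simp)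
    then show "\<theta> \<in> Theta_k K \<delta> 1" unfolding Theta_1_eq[OF assms(4)] using K by blast
  qed
  also have "\<dots> \<in> sets \<pi>"
  proof (rule sets.Int)
    show "{\<theta> \<in> space \<pi>. \<bar>\<theta> 0\<bar> \<le> K} \<in> sets \<pi>" by measurable
    have "{\<theta> \<in> space \<pi>. \<theta> q = \<theta> 0} \<in> sets \<pi>" for q by measurable
    then show "{\<theta> \<in> space \<pi>. \<forall>q\<in>\<rat>\<inter>{0..<1}. \<theta> q = \<theta> 0} \<in> sets \<pi>"
      by (intro sets.sets_Collect_countable_All' countable_subset[OF _ countable_rat]) auto
  qed
  finally show ?thesis .
qed

section \<open>Measurability and bounds for the likelihood and the posterior\<close>

lemma sets_sample_law [measurable_cong]: "sets (sample_law \<theta> n) = sets (PiM {..<n} (\<lambda>_. borel \<Otimes>\<^sub>M borel))"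
  unfolding sample_law_def by (intro sets_PiM_cong) (auto simp: obs_law_def)

text \<open>Joint measurability makes the integrals over \<theta> in the posterior measurable
  functions of the sample.\<close>

lemma likelihood_measurable:
  assumes sp: "space \<pi> = Theta kmax K \<delta>" and se: "sets \<pi> = sets (Theta_borel kmax K \<delta>)"
  shows "(\<lambda>(z, \<theta>). likelihood n z \<theta>) \<in> borel_measurable (PiM {..<n} (\<lambda>_. borel \<Otimes>\<^sub>M borel) \<Otimes>\<^sub>M \<pi>)"
proof -
  let ?M = "PiM {..<n} (\<lambda>_. borel \<Otimes>\<^sub>M borel) \<Otimes>\<^sub>M \<pi>"
  have "(\<lambda>p. obs_density (snd p) (fst p i)) \<in> borel_measurable ?M" if i: "i < n" for i
  proof -
    have [measurable]: "(\<lambda>p. fst p i) \<in> ?M \<rightarrow>\<^sub>M borel \<Otimes>\<^sub>M borel"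
      using i by (intro measurable_compose[OF measurable_fst measurable_component_singleton]) auto
    have "(\<lambda>p. (fst (fst p i), snd p)) \<in> ?M \<rightarrow>\<^sub>M borel \<Otimes>\<^sub>M \<pi>" by measurable
    from measurable_compose[OF this Theta_joint_eval_measurable[OF sp se]]
    have [measurable]: "(\<lambda>p. snd p (fst (fst p i))) \<in> borel_measurable ?M" by simp
    show ?thesis unfolding obs_density_def case_prod_beta normal_density_def by measurable
  qed
  then show ?thesis unfolding likelihood_def case_prod_beta by (intro borel_measurable_prod) auto
qed

text \<open>The unit-variance normal density peaks at \<open>1 / sqrt (2 * pi)\<close>, which is
  below 1. The bound gives integrability under every prior.\<close>

lemma likelihood_bounds: "0 \<le> likelihood n z \<theta>" "likelihood n z \<theta> \<le> 1"
proof -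
  have nd: "normal_density m 1 y \<le> 1" for m y
  proof -
    have "1 \<le> sqrt (2 * pi)" using pi_gt3 by simp
    then have "1 / sqrt (2 * pi) \<le> 1" by simp
    moreover have "exp (- (y - m)\<^sup>2 / 2) \<le> 1" by simp
    ultimately have "1 / sqrt (2 * pi) * exp (- (y - m)\<^sup>2 / 2) \<le> 1"
      by (intro mult_le_one) auto
    then show ?thesis by (simp add: normal_density_def)
  qed
  have "0 \<le> obs_density \<theta> w" "obs_density \<theta> w \<le> 1" for w
    using nd by (auto simp: obs_density_def indicator_def split: prod.split)
  then show "0 \<le> likelihood n z \<theta>" "likelihood n z \<theta> \<le> 1"
    unfolding likelihood_def by (simp_all add: prod_nonneg prod_le_1)
qed

lemma posterior_measurable:
  assumes pr: "is_prior kmax K \<delta> \<pi>" and A: "A \<in> sets \<pi>"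
  shows "(\<lambda>z. posterior \<pi> n z A) \<in> borel_measurable (sample_law \<theta> n)"
proof -
  have sp: "space \<pi> = Theta kmax K \<delta>" and se: "sets \<pi> = sets (Theta_borel kmax K \<delta>)"
    and "prob_space \<pi>" using pr by (auto simp: is_prior_def)
  interpret prob_space \<pi> by fact
  note [measurable] = likelihood_measurable[OF sp se, of n] A
  show ?thesis unfolding posterior_def set_lebesgue_integral_def by measurable
qed

lemma likelihood_integrable:
  assumes pr: "is_prior kmax K \<delta> \<pi>" and z: "z \<in> space (sample_law \<theta> n)"
  shows "integrable \<pi> (likelihood n z)"
proof -
  have sp: "space \<pi> = Theta kmax K \<delta>" and se: "sets \<pi> = sets (Theta_borel kmax K \<delta>)"
    and "prob_space \<pi>" using pr by (auto simp: is_prior_def)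
  interpret prob_space \<pi> by fact
  have "z \<in> space (PiM {..<n} (\<lambda>_. borel \<Otimes>\<^sub>M borel))"
    using z sets_eq_imp_space_eq[OF sets_sample_law] by auto
  from measurable_compose[OF measurable_Pair1'[OF this] likelihood_measurable[OF sp se]]
  have "likelihood n z \<in> borel_measurable \<pi>" by simp
  then show ?thesis
    by (intro integrable_const_bound[where B = 1]) (auto simp: likelihood_bounds)
qed

lemma posterior_mono:
  assumes pr: "is_prior kmax K \<delta> \<pi>" and z: "z \<in> space (sample_law \<theta> n)"
    and A: "A \<in> sets \<pi>" and B: "B \<in> sets \<pi>" and "A \<subseteq> B"
  shows "posterior \<pi> n z A \<le> posterior \<pi> n z B"
  unfolding posterior_def set_lebesgue_integral_def
proof (intro divide_right_mono integral_mono)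
  show "integrable \<pi> (\<lambda>x. indicator A x *\<^sub>R likelihood n z x)"
    "integrable \<pi> (\<lambda>x. indicator B x *\<^sub>R likelihood n z x)"
    by (intro integrable_mult_indicator A B likelihood_integrable[OF pr z])+
qed (use assms(5) likelihood_bounds in \<open>auto simp: indicator_def intro: integral_nonneg_AE\<close>)

lemma posterior_bounds:
  assumes pr: "is_prior kmax K \<delta> \<pi>" and z: "z \<in> space (sample_law \<theta> n)" and A: "A \<in> sets \<pi>"
  shows "0 \<le> posterior \<pi> n z A" "posterior \<pi> n z A \<le> 1"
proof -
  show "0 \<le> posterior \<pi> n z A"
    using posterior_mono[OF pr z _ A, of "{}"] by (simp add: posterior_def set_lebesgue_integral_def)
  have "posterior \<pi> n z A \<le> posterior \<pi> n z (space \<pi>)"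
    using posterior_mono[OF pr z A] sets.sets_into_space[OF A] by auto
  also have "\<dots> \<le> 1"
  proof -
    have "(LINT x:space \<pi>|\<pi>. likelihood n z x) = (LINT x|\<pi>. likelihood n z x)"
      unfolding set_lebesgue_integral_def by (intro Bochner_Integration.integral_cong) auto
    \<comment> \<open>The quotient is 1, or 0 by the convention for division by zero when the
      evidence vanishes.\<close>
    then show ?thesis by (simp add: posterior_def)
  qed
  finally show "posterior \<pi> n z A \<le> 1" .
qed

section \<open>Change of measure\<close>

text \<open>The likelihood ratio of one observation under \<theta> against the zero function. Both
  share the same uniform factor in \<open>x\<close>, so only the Gaussian shift remains.\<close>

definition gauss_ratio :: "(real \<Rightarrow> real) \<Rightarrow> real \<times> real \<Rightarrow> real" where
  "gauss_ratio \<theta> = (\<lambda>(x, y). exp (\<theta> x * y - (\<theta> x)\<^sup>2 / 2))"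

lemma gauss_ratio_measurable [measurable]:
  assumes [measurable]: "\<theta> \<in> borel_measurable borel"
  shows "gauss_ratio \<theta> \<in> borel_measurable (borel \<Otimes>\<^sub>M borel)"
  unfolding gauss_ratio_def by measurable

lemma obs_density_measurable [measurable]:
  assumes [measurable]: "\<theta> \<in> borel_measurable borel"
  shows "obs_density \<theta> \<in> borel_measurable (borel \<Otimes>\<^sub>M borel)"
  unfolding obs_density_def normal_density_def by measurable

lemma sets_obs_law [measurable_cong, simp]: "sets (obs_law \<theta>) = sets (borel \<Otimes>\<^sub>M borel)"
  by (simp add: obs_law_def)

lemma prob_space_obs_law:
  assumes [measurable]: "\<theta> \<in> borel_measurable borel"
  shows "prob_space (obs_law \<theta>)"
  unfolding obs_law_def
proof (rule prob_space.prob_space_distr)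
  interpret N: prob_space "density lborel std_normal_density"
    by (rule prob_space_normal_density) simp
  interpret U: prob_space "uniform_measure lborel {0..<1::real}"
    by (rule prob_space_uniform_measure) auto
  interpret P: pair_prob_space "uniform_measure lborel {0..<1::real}" "density lborel std_normal_density" ..
  show "prob_space (uniform_measure lborel {0..<1::real} \<Otimes>\<^sub>M density lborel std_normal_density)"
    by (rule P.prob_space_axioms)
qed measurable

lemma prob_space_sample_law:
  "\<theta> \<in> borel_measurable borel \<Longrightarrow> prob_space (sample_law \<theta> n)"
  unfolding sample_law_def by (intro prob_space_PiM prob_space_obs_law)

text \<open>Expanding \<open>(y - \<theta> x)^2\<close> in the Gaussian exponent splits off the
  density for mean zero.\<close>

lemma obs_law_change:
  assumes [measurable]: "\<theta> \<in> borel_measurable borel"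
  shows "obs_law \<theta> = density (obs_law (\<lambda>_. 0)) (gauss_ratio \<theta>)"
proof -
  have "obs_density \<theta> z = obs_density (\<lambda>_. 0) z * gauss_ratio \<theta> z" for z
    by (auto simp: obs_density_def gauss_ratio_def normal_density_def indicator_def mult_exp_exp
        power2_eq_square field_simps split: prod.split)
  moreover have "obs_density (\<lambda>_. 0) z \<ge> 0" for z
    by (auto simp: obs_density_def indicator_def split: prod.split)
  ultimately have "ennreal (obs_density \<theta> z) = ennreal (obs_density (\<lambda>_. 0) z) * ennreal (gauss_ratio \<theta> z)" for z
    by (simp add: ennreal_mult')
  then show ?thesis
    by (simp add: obs_law_eq_density density_density_eq)
qed

text \<open>A product measure is determined by its values on boxes, and there the integral of a
  product of one-coordinate functions factorises.\<close>

lemma sample_law_change: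
  assumes [measurable]: "\<theta> \<in> borel_measurable borel"
  shows "sample_law \<theta> n = density (sample_law (\<lambda>_. 0) n) (\<lambda>z. ennreal (\<Prod>i<n. gauss_ratio \<theta> (z i)))"
proof -
  interpret P0: product_prob_space "\<lambda>_::nat. obs_law (\<lambda>_. 0)" "{..<n}"
    by (auto simp: product_prob_space_def product_sigma_finite_def product_prob_space_axioms_def
        intro!: prob_space_obs_law prob_space_imp_sigma_finite)
  interpret P1: product_prob_space "\<lambda>_::nat. obs_law \<theta>" "{..<n}"
    by (auto simp: product_prob_space_def product_sigma_finite_def product_prob_space_axioms_def
        intro!: prob_space_obs_law prob_space_imp_sigma_finite)
  have gr: "gauss_ratio \<theta> z \<ge> 0" for z by (simp add: gauss_ratio_def split: prod.split)
  have ge: "ennreal (\<Prod>i<n. gauss_ratio \<theta> (z i)) = (\<Prod>i<n. ennreal (gauss_ratio \<theta> (z i)))" for z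
    using gr by (simp add: prod_ennreal)
  show ?thesis unfolding sample_law_def ge
  proof (rule P1.PiM_eqI[symmetric])
    fix A assume A: "\<And>i. i \<in> {..<n} \<Longrightarrow> A i \<in> sets (obs_law \<theta>)"
    then have A': "A i \<in> sets (borel \<Otimes>\<^sub>M borel)" if "i < n" for i using that by simp
    have "emeasure (density (PiM {..<n} (\<lambda>_. obs_law (\<lambda>_. 0))) (\<lambda>z. \<Prod>i<n. ennreal (gauss_ratio \<theta> (z i)))) (PiE {..<n} A)
        = (\<integral>\<^sup>+z. (\<Prod>i<n. ennreal (gauss_ratio \<theta> (z i))) * indicator (PiE {..<n} A) z \<partial>PiM {..<n} (\<lambda>_. obs_law (\<lambda>_. 0)))"
      using A' by (intro emeasure_density sets_PiM_I_finite) auto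
    also have "\<dots> = (\<integral>\<^sup>+z. (\<Prod>i<n. ennreal (gauss_ratio \<theta> (z i)) * indicator (A i) (z i)) \<partial>PiM {..<n} (\<lambda>_. obs_law (\<lambda>_. 0)))"
    proof (rule nn_integral_cong)
      fix z assume z: "z \<in> space (PiM {..<n} (\<lambda>_. obs_law (\<lambda>_. 0)))"
      have "indicator (PiE {..<n} A) z = (\<Prod>i<n. indicator (A i) (z i) :: ennreal)"
      proof (cases "z \<in> PiE {..<n} A")
        case False
        then obtain i where "i < n" "z i \<notin> A i" using z by (auto simp: space_PiM PiE_def)
        then have "(\<Prod>i<n. indicator (A i) (z i) :: ennreal) = 0"
          by (intro prod_zero bexI[of _ i]) auto
        then show ?thesis using False by simp
      next
        case True
        then have "(\<Prod>i<n. indicator (A i) (z i) :: ennreal) = (\<Prod>i<n. 1)"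
          by (intro prod.cong refl) (simp add: PiE_mem[OF True])
        then show ?thesis using True by simp
      qed
      then show "(\<Prod>i<n. ennreal (gauss_ratio \<theta> (z i))) * indicator (PiE {..<n} A) z
          = (\<Prod>i<n. ennreal (gauss_ratio \<theta> (z i)) * indicator (A i) (z i))"
        by (simp add: prod.distrib)
    qed
    also have "\<dots> = (\<Prod>i<n. \<integral>\<^sup>+w. ennreal (gauss_ratio \<theta> w) * indicator (A i) w \<partial>obs_law (\<lambda>_. 0))"
      using A' by (intro P0.product_nn_integral_prod) auto
    also have "\<dots> = (\<Prod>i<n. emeasure (obs_law \<theta>) (A i))"
      using A' by (intro prod.cong refl) (simp add: obs_law_change[OF assms] emeasure_density)
    finally show "emeasure (density (PiM {..<n} (\<lambda>_. obs_law (\<lambda>_. 0))) (\<lambda>z. \<Prod>i<n. ennreal (gauss_ratio \<theta> (z i)))) (PiE {..<n} A)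
      = (\<Prod>i\<in>{..<n}. emeasure (obs_law \<theta>) (A i))" .
  qed (auto intro!: sets_PiM_cong)
qed

text \<open>Given \<open>x\<close>, the second moment of the ratio is
  \<open>exp ((\<theta> x)^2)\<close>; averaging over \<open>x\<close> preserves the bound.\<close>

lemma nn_integral_gauss_ratio_sq:
  assumes [measurable]: "\<theta> \<in> borel_measurable borel" and b: "\<And>x. \<bar>\<theta> x\<bar> \<le> b"
  shows "(\<integral>\<^sup>+w. ennreal ((gauss_ratio \<theta> w)\<^sup>2) \<partial>obs_law (\<lambda>_. 0)) \<le> ennreal (exp (b\<^sup>2))"
proof -
  \<comment> \<open>Completing the square: squaring the ratio moves the Gaussian mean to
    \<open>2 * s\<close> at the cost of the factor \<open>exp (s^2)\<close>.\<close>
  have eq: "std_normal_density y * (exp (s * y - s\<^sup>2 / 2))\<^sup>2 = exp (s\<^sup>2) * normal_density (2 * s) 1 y" for s y :: real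
    by (simp add: normal_density_def mult_exp_exp flip: exp_of_nat_mult)
      (simp add: power2_eq_square field_simps)
  have "(\<integral>\<^sup>+w. ennreal ((gauss_ratio \<theta> w)\<^sup>2) \<partial>obs_law (\<lambda>_. 0))
      = (\<integral>\<^sup>+w. ennreal (obs_density (\<lambda>_. 0) w) * ennreal ((gauss_ratio \<theta> w)\<^sup>2) \<partial>(lborel \<Otimes>\<^sub>M lborel))"
    by (subst obs_law_eq_density) (auto intro!: nn_integral_density)
  also have "\<dots> = (\<integral>\<^sup>+x. \<integral>\<^sup>+y. ennreal (obs_density (\<lambda>_. 0) (x, y)) * ennreal ((gauss_ratio \<theta> (x, y))\<^sup>2) \<partial>lborel \<partial>lborel)"
    by (subst lborel.nn_integral_fst[symmetric]) auto
  also have "\<dots> \<le> (\<integral>\<^sup>+x. ennreal (exp (b\<^sup>2)) * indicator {0..<1::real} x \<partial>lborel)"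
  proof (rule nn_integral_mono)
    fix x
    have "(\<integral>\<^sup>+y. ennreal (obs_density (\<lambda>_. 0) (x, y)) * ennreal ((gauss_ratio \<theta> (x, y))\<^sup>2) \<partial>lborel)
      = (\<integral>\<^sup>+y. (ennreal (exp ((\<theta> x)\<^sup>2)) * indicator {0..<1} x) * ennreal (normal_density (2 * \<theta> x) 1 y) \<partial>lborel)"
      by (intro nn_integral_cong)
        (auto simp: obs_density_def gauss_ratio_def indicator_def eq simp flip: ennreal_mult)
    also have "\<dots> = (ennreal (exp ((\<theta> x)\<^sup>2)) * indicator {0..<1} x) * (\<integral>\<^sup>+y. ennreal (normal_density (2 * \<theta> x) 1 y) \<partial>lborel)"
      by (intro nn_integral_cmult) auto
    also have "(\<integral>\<^sup>+y. ennreal (normal_density (2 * \<theta> x) 1 y) \<partial>lborel) = 1"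
      using prob_space.emeasure_space_1[OF prob_space_normal_density[of 1 "2 * \<theta> x"]]
      by (simp add: emeasure_density)
    also have "ennreal (exp ((\<theta> x)\<^sup>2)) * indicator {0..<1} x * 1 \<le> ennreal (exp (b\<^sup>2)) * indicator {0..<1::real} x"
      using b[of x] by (auto simp: indicator_def abs_le_square_iff[symmetric] intro!: ennreal_leI)
    finally show "(\<integral>\<^sup>+y. ennreal (obs_density (\<lambda>_. 0) (x, y)) * ennreal ((gauss_ratio \<theta> (x, y))\<^sup>2) \<partial>lborel)
      \<le> ennreal (exp (b\<^sup>2)) * indicator {0..<1::real} x" .
  qed
  also have "\<dots> = ennreal (exp (b\<^sup>2))" by (simp add: nn_integral_cmult)
  finally show ?thesis .
qed

text \<open>
  The arithmetic-geometric mean inequality \<open>2 L f \<le> s f\<^sup>2 + L\<^sup>2 / s\<close>, with \<open>f\<^sup>2 \<le> f\<close>, replaces the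
  Cauchy-Schwarz inequality.
\<close>

lemma expectation_change:
  assumes [measurable]: "\<theta> \<in> borel_measurable borel" and b: "\<And>x. \<bar>\<theta> x\<bar> \<le> b"
    and f [measurable]: "f \<in> borel_measurable (sample_law (\<lambda>_. 0) n)"
    and f01: "\<And>z. z \<in> space (sample_law (\<lambda>_. 0) n) \<Longrightarrow> 0 \<le> f z \<and> f z \<le> 1"
    and s: "s > 0"
  shows "(LINT z|sample_law \<theta> n. f z)
    \<le> (s * (LINT z|sample_law (\<lambda>_. 0) n. f z) + exp (real n * b\<^sup>2) / s) / 2"
proof -
  let ?P = "sample_law (\<lambda>_. 0) n"
  interpret P: prob_space ?P by (rule prob_space_sample_law) simp
  interpret P0: product_prob_space "\<lambda>_::nat. obs_law (\<lambda>_. 0)" "{..<n}"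
    by (auto simp: product_prob_space_def product_sigma_finite_def product_prob_space_axioms_def
        intro!: prob_space_obs_law prob_space_imp_sigma_finite)
  define L where "L z = (\<Prod>i<n. gauss_ratio \<theta> (z i))" for z :: "nat \<Rightarrow> real \<times> real"
  have L0: "L z \<ge> 0" for z
    unfolding L_def gauss_ratio_def by (auto intro!: prod_nonneg split: prod.split)
  have Lm [measurable]: "L \<in> borel_measurable ?P"
    unfolding L_def by measurable
  \<comment> \<open>By independence the second moment of \<open>L\<close> is the product of the
    second moments of its factors.\<close>
  have "(\<integral>\<^sup>+z. ennreal ((L z)\<^sup>2) \<partial>?P) = (\<integral>\<^sup>+z. (\<Prod>i<n. ennreal ((gauss_ratio \<theta> (z i))\<^sup>2)) \<partial>?P)"
    by (simp add: L_def prod_power_distrib prod_ennreal)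
  also have "\<dots> = (\<Prod>i<n. \<integral>\<^sup>+w. ennreal ((gauss_ratio \<theta> w)\<^sup>2) \<partial>obs_law (\<lambda>_. 0))"
    unfolding sample_law_def by (intro P0.product_nn_integral_prod) auto
  also have "\<dots> \<le> (\<Prod>i<n. ennreal (exp (b\<^sup>2)))"
    by (intro prod_mono_ennreal nn_integral_gauss_ratio_sq b) auto
  also have "\<dots> = ennreal (exp (real n * b\<^sup>2))"
    by (simp add: ennreal_power exp_of_nat_mult)
  finally have LL: "(\<integral>\<^sup>+z. ennreal ((L z)\<^sup>2) \<partial>?P) \<le> ennreal (exp (real n * b\<^sup>2))" .
  then have iL: "integrable ?P (\<lambda>z. (L z)\<^sup>2)"
    by (intro integrableI_bounded) (auto simp: le_less_trans)
  have LL': "(LINT z|?P. (L z)\<^sup>2) \<le> exp (real n * b\<^sup>2)"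
    using LL iL by (simp add: nn_integral_eq_integral)
  have if': "integrable ?P f"
    by (intro P.integrable_const_bound[where B = 1]) (use f01 in \<open>auto intro!: AE_I2\<close>)
  have pt: "L z * f z \<le> (s * f z + (L z)\<^sup>2 / s) / 2" if "z \<in> space ?P" for z
  proof -
    have "0 \<le> (s * f z - L z)\<^sup>2 / (2 * s)" using s by simp
    also have "\<dots> = (s * (f z)\<^sup>2 + (L z)\<^sup>2 / s) / 2 - L z * f z"
      using s by (simp add: power2_eq_square field_simps)
    finally have "L z * f z \<le> (s * (f z)\<^sup>2 + (L z)\<^sup>2 / s) / 2" by simp
    moreover
    have "s * (f z)\<^sup>2 \<le> s * f z"
      using f01[OF that] s by (intro mult_left_mono) (auto simp: power2_eq_square mult_left_le)
    then have "(s * (f z)\<^sup>2 + (L z)\<^sup>2 / s) / 2 \<le> (s * f z + (L z)\<^sup>2 / s) / 2"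
      by (intro divide_right_mono add_right_mono) auto
    ultimately show ?thesis by (rule order_trans)
  qed
  have "(LINT z|sample_law \<theta> n. f z) = (LINT z|?P. L z * f z)"
    using L0 by (subst sample_law_change[OF assms(1)]) (simp add: L_def[symmetric] integral_density)
  also have "\<dots> \<le> (LINT z|?P. (s * f z + (L z)\<^sup>2 / s) / 2)"
  proof (rule integral_mono_AE')
    show "integrable ?P (\<lambda>z. (s * f z + (L z)\<^sup>2 / s) / 2)" using if' iL by auto
  qed (use pt f01 s in \<open>auto intro!: AE_I2 add_nonneg_nonneg\<close>)
  also have "\<dots> = (s * (LINT z|?P. f z) + (LINT z|?P. (L z)\<^sup>2) / s) / 2"
    using if' iL by simp
  also have "\<dots> \<le> (s * (LINT z|?P. f z) + exp (real n * b\<^sup>2) / s) / 2"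
    using LL' s by (simp add: divide_right_mono)
  finally show ?thesis .
qed

text \<open>The probability spaces vary with \<open>n\<close>. Splitting at level
  \<open>r / 2\<close> bounds the expectation by \<open>r / 2\<close> plus the probability of
  exceeding it, because \<open>f n\<close> is at most 1.\<close>

lemma expectation_tendsto_zero:
  fixes f :: "nat \<Rightarrow> 'a \<Rightarrow> real"
  assumes P: "\<And>n. prob_space (P n)" and [measurable]: "\<And>n. f n \<in> borel_measurable (P n)"
    and f01: "\<And>n z. z \<in> space (P n) \<Longrightarrow> 0 \<le> f n z \<and> f n z \<le> 1"
    and conv: "\<And>\<eta>. \<eta> > 0 \<Longrightarrow> (\<lambda>n. measure (P n) {z \<in> space (P n). f n z > \<eta>}) \<longlonglongrightarrow> 0"
  shows "(\<lambda>n. LINT z|P n. f n z) \<longlonglongrightarrow> 0"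
proof (rule LIMSEQ_I)
  fix r :: real assume r: "r > 0"
  have nn: "0 \<le> (LINT z|P n. f n z)" for n
    using f01 by (intro integral_nonneg_AE) (auto intro!: AE_I2)
  have bd: "(LINT z|P n. f n z) \<le> r / 2 + measure (P n) {z \<in> space (P n). f n z > r / 2}" for n
  proof -
    interpret prob_space "P n" by (rule P)
    let ?B = "{z \<in> space (P n). f n z > r / 2}"
    have B: "?B \<in> sets (P n)" by measurable
    have "(LINT z|P n. f n z) \<le> (LINT z|P n. r / 2 + indicator ?B z)"
    proof (rule integral_mono)
      show "integrable (P n) (f n)"
        by (intro integrable_const_bound[where B = 1]) (use f01 in \<open>auto intro!: AE_I2\<close>)
      show "integrable (P n) (\<lambda>z. r / 2 + indicator ?B z :: real)"
        using B by (intro Bochner_Integration.integrable_add integrable_real_indicator)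
          (auto simp: less_top[symmetric])
      show "f n z \<le> r / 2 + indicator ?B z" if "z \<in> space (P n)" for z
        using f01[OF that] r that by (auto simp: indicator_def not_less intro: order_trans)
    qed
    also have "\<dots> = r / 2 + measure (P n) ?B"
      using B by (subst Bochner_Integration.integral_add) (auto simp: prob_space less_top[symmetric])
    finally show ?thesis .
  qed
  have "\<forall>\<^sub>F n in sequentially. measure (P n) {z \<in> space (P n). f n z > r / 2} < r / 2"
    using conv[of "r / 2"] r by (intro order_tendstoD) auto
  then have "\<forall>\<^sub>F n in sequentially. norm ((LINT z|P n. f n z) - 0) < r"
  proof eventually_elim
    case (elim n)
    then show ?case using bd[of n] nn[of n] by simp
  qed
  then show "\<exists>no. \<forall>n\<ge>no. norm ((LINT z|P n. f n z) - 0) < r"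
    by (simp add: eventually_sequentially)
qed

section \<open>The lower bound\<close>

theorem theorem5:
  fixes kmax :: nat and K \<delta> :: real and \<pi> :: "(real \<Rightarrow> real) measure"
  assumes "K > 0" and "\<delta> > 0"
    and "kmax \<ge> 2" and "\<delta> \<le> 1 / 2"
    and "is_prior kmax K \<delta> \<pi>"
    and "model_consistent kmax K \<delta> \<pi>"
  shows "\<exists>M :: nat \<Rightarrow> real. filterlim M at_top sequentially \<and>
    (\<lambda>n. SUP \<theta>'\<in>Theta kmax K \<delta>.
        LINT z|sample_law \<theta>' n.
          posterior \<pi> n z {\<theta> \<in> Theta kmax K \<delta>. L2_norm01 (\<lambda>x. \<theta> x - \<theta>' x) > M n * (1 / sqrt (real n))})
      \<longlonglongrightarrow> 1"
proof -
  note pr = assms(5)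
  have sp: "space \<pi> = Theta kmax K \<delta>" and se: "sets \<pi> = sets (Theta_borel kmax K \<delta>)"
    using pr by (auto simp: is_prior_def)
  let ?T1 = "Theta_k K \<delta> 1"
  have T1: "?T1 \<in> sets \<pi>" using Theta_1_measurable[OF sp se] assms by auto
  have T1sub: "?T1 \<subseteq> Theta kmax K \<delta>"
    using assms(3) by (auto simp: Theta_def intro!: bexI[of _ 1])
  define P0 where "P0 n = sample_law (\<lambda>_. 0) n" for n
  \<comment> \<open>All sample laws share one measurable space, so bounds established on it hold
    under every truth.\<close>
  have sP: "space (sample_law \<theta> n) = space (P0 n)" for \<theta> n
    unfolding P0_def by (intro sets_eq_imp_space_eq) (simp add: sets_sample_law)
  \<comment> \<open>The posterior mass off the constants; it equals 1 where the evidence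
    vanishes.\<close>
  define f where "f n z = 1 - posterior \<pi> n z ?T1" for n z
  have fm: "f n \<in> borel_measurable (sample_law \<theta> n)" for \<theta> n
    unfolding f_def using posterior_measurable[OF pr T1] by (intro borel_measurable_diff) auto
  have f01: "0 \<le> f n z \<and> f n z \<le> 1" if "z \<in> space (P0 n)" for n z
    using posterior_bounds[OF pr _ T1] that unfolding f_def P0_def by auto
  define e where "e n = (LINT z|P0 n. f n z)" for n
  have e_nonneg: "0 \<le> e n" for n
    unfolding e_def using f01 by (intro integral_nonneg_AE) (auto intro!: AE_I2)
  have e: "e \<longlonglongrightarrow> 0"
    unfolding e_def
  proof (rule expectation_tendsto_zero)
    fix \<eta> :: real assume \<eta>: "\<eta> > 0"
    \<comment> \<open>Consistency is applied at a single truth, the zero function with one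
      segment.\<close>
    have "(\<lambda>n. measure (P0 n) {z \<in> space (P0 n). \<bar>posterior \<pi> n z ?T1 - 1\<bar> > \<eta>}) \<longlonglongrightarrow> 0"
      using assms(6) zero_in_Theta[of K kmax \<delta>] zero_has_change_points assms \<eta>
      unfolding model_consistent_def P0_def by blast
    moreover have "{z \<in> space (P0 n). \<bar>posterior \<pi> n z ?T1 - 1\<bar> > \<eta>} = {z \<in> space (P0 n). f n z > \<eta>}" for n
      using f01[of _ n] by (auto simp: f_def)
    ultimately show "(\<lambda>n. measure (P0 n) {z \<in> space (P0 n). f n z > \<eta>}) \<longlonglongrightarrow> 0" by simp
  qed (use f01 fm in \<open>auto simp: P0_def intro!: prob_space_sample_law\<close>)
  \<comment> \<open>\<open>e n\<close> may vanish, and \<open>b n \<le> K\<close> requires \<open>ln (1 / e n)\<close> to be of smaller order than \<open>n\<close>.\<close>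
  define d where "d n = e n + 1 / (real n + 1)" for n
  have d_pos: "d n > 0" for n using e_nonneg[of n] by (simp add: d_def add_nonneg_pos)
  have d0: "d \<longlonglongrightarrow> 0"
  proof -
    have "(\<lambda>n. 1 / (real n + 1)) \<longlonglongrightarrow> 0" by real_asymp
    from tendsto_add[OF e this] show ?thesis by (simp add: d_def[abs_def])
  qed
  \<comment> \<open>The value of \<open>n * (b n)^2\<close>, chosen so that the second-moment bound
    \<open>exp (c n)\<close> is \<open>d n powr (- 1 / 4)\<close>.\<close>
  define c where "c n = - ln (d n) / 4" for n
  have c_top: "filterlim c at_top sequentially"
  proof -
    have "filterlim d (at_right 0) sequentially"
      using d0 d_pos less_imp_neq[OF d_pos, THEN not_sym] by (simp add: filterlim_at)
    from filterlim_compose[OF ln_at_0 this] have "filterlim (\<lambda>n. - ln (d n)) at_top sequentially"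
      by (simp add: filterlim_uminus_at_top)
    then have "filterlim (\<lambda>n. 1 / 4 * - ln (d n)) at_top sequentially"
      by (intro filterlim_tendsto_pos_mult_at_top[OF tendsto_const]) auto
    then show ?thesis by (simp add: c_def[abs_def])
  qed
  \<comment> \<open>The summand \<open>1 / (real n + 1)\<close> in \<open>d\<close> caps
    \<open>c\<close> at logarithmic growth, which later gives \<open>b n \<le> K\<close>.\<close>
  have c_le: "c n \<le> ln (real n + 1) / 4" for n
  proof -
    have "ln (1 / (real n + 1)) \<le> ln (d n)"
      using e_nonneg[of n] d_pos[of n] by (subst ln_le_cancel_iff) (auto simp: d_def)
    then show ?thesis by (simp add: c_def ln_div)
  qed
  \<comment> \<open>The factor 1/3 places the radius \<open>M n / sqrt (real n) = b n / 3\<close>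
    strictly below the distance \<open>b n / 2\<close> from the half step to the constants.\<close>
  define M where "M n = sqrt (c n) / 3" for n
  define b where "b n = sqrt (c n / real n)" for n
  have M_top: "filterlim M at_top sequentially"
    using filterlim_tendsto_pos_mult_at_top[OF tendsto_const _ filterlim_compose[OF sqrt_at_top c_top], of "1 / 3"]
    by (simp add: M_def[abs_def])
  let ?A = "\<lambda>n \<theta>'. {\<theta> \<in> Theta kmax K \<delta>. L2_norm01 (\<lambda>x. \<theta> x - \<theta>' x) > M n * (1 / sqrt (real n))}"
  let ?E = "\<lambda>n \<theta>'. LINT z|sample_law \<theta>' n. posterior \<pi> n z (?A n \<theta>')"
  have A: "?A n \<theta>' \<in> sets \<pi>" if "\<theta>' \<in> Theta kmax K \<delta>" for n \<theta>'
    by (rule far_set_measurable[OF se that])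
  have int: "integrable (sample_law \<theta>' n) (\<lambda>z. posterior \<pi> n z B)"
    if "\<theta>' \<in> Theta kmax K \<delta>" "B \<in> sets \<pi>" for n \<theta>' B
  proof -
    interpret prob_space "sample_law \<theta>' n"
      using Theta_measurable[OF that(1)] by (rule prob_space_sample_law)
    show ?thesis
      using posterior_measurable[OF pr that(2)] posterior_bounds[OF pr _ that(2)]
      by (intro integrable_const_bound[where B = 1]) (auto intro!: AE_I2)
  qed
  have E_le: "?E n \<theta>' \<le> 1" if th: "\<theta>' \<in> Theta kmax K \<delta>" for n \<theta>'
  proof -
    interpret prob_space "sample_law \<theta>' n"
      using Theta_measurable[OF th] by (rule prob_space_sample_law)
    have "?E n \<theta>' \<le> (LINT z|sample_law \<theta>' n. 1)"
      using posterior_bounds[OF pr _ A[OF th]] int[OF th A[OF th]] by (intro integral_mono) auto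
    then show ?thesis by (simp add: prob_space)
  qed
  have zero: "(\<lambda>_. 0) \<in> Theta kmax K \<delta>" using zero_in_Theta assms by blast
  have upper: "(SUP \<theta>'\<in>Theta kmax K \<delta>. ?E n \<theta>') \<le> 1" for n
    using E_le zero by (intro cSUP_least) auto
  \<comment> \<open>Eventually, because \<open>c n > 0\<close>, \<open>d n < 1\<close> and
    \<open>b n \<le> K\<close> may fail for small \<open>n\<close>; the half step of height
    \<open>b n\<close> is the witness for the supremum.\<close>
  have lower: "\<forall>\<^sub>F n in sequentially. 1 - d n powr (1 / 4) \<le> (SUP \<theta>'\<in>Theta kmax K \<delta>. ?E n \<theta>')"
  proof -
    have "\<forall>\<^sub>F n in sequentially. c n > 0" using c_top by (simp add: filterlim_at_top_dense)
    moreover have "\<forall>\<^sub>F n in sequentially. d n < 1" using d0 by (intro order_tendstoD) auto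
    moreover have "(\<lambda>n. ln (real n + 1) / 4 / real n) \<longlonglongrightarrow> 0" by real_asymp
    then have "\<forall>\<^sub>F n in sequentially. ln (real n + 1) / 4 / real n < K\<^sup>2"
      using assms(1) by (intro order_tendstoD) auto
    moreover have "\<forall>\<^sub>F n in sequentially. n > (0::nat)" by (rule eventually_gt_at_top)
    ultimately show ?thesis
    proof eventually_elim
      case (elim n)
      have b0: "b n > 0" using elim by (simp add: b_def)
      have bsq: "(b n)\<^sup>2 = c n / real n" using elim by (simp add: b_def)
      have "c n / real n \<le> ln (real n + 1) / 4 / real n" using c_le[of n] by (intro divide_right_mono) auto
      then have "(b n)\<^sup>2 \<le> K\<^sup>2" unfolding bsq using elim(3) by linarith
      then have "b n \<le> K" by (rule power2_le_imp_le) (use assms(1) in simp)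
      define \<theta> where "\<theta> = (\<lambda>x::real. b n * indicator {1 / 2..<1} x)"
      have th: "\<theta> \<in> Theta kmax K \<delta>"
        unfolding \<theta>_def using half_step_in_Theta assms \<open>b n \<le> K\<close> b0 by simp
      have sub: "?T1 \<subseteq> ?A n \<theta>"
      proof
        fix g assume g: "g \<in> ?T1"
        then obtain a where ga: "g = (\<lambda>x. a * indicator {0..<1} x)"
          using Theta_1_eq[of \<delta> K] assms by auto
        have "M n * (1 / sqrt (real n)) = b n / 3" by (simp add: M_def b_def real_sqrt_divide)
        also have "\<dots> < \<bar>b n\<bar> / 2" using b0 by simp
        also have "\<dots> \<le> L2_norm01 (\<lambda>x. g x - \<theta> x)"
          unfolding ga \<theta>_def by (rule L2_dist_const_half_step)
        finally show "g \<in> ?A n \<theta>" using g T1sub by blast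
      qed
      interpret prob_space "sample_law \<theta> n"
        using Theta_measurable[OF th] by (rule prob_space_sample_law)
      \<comment> \<open>With this weight the two terms of \<open>expectation_change\<close> become
        \<open>d n powr (1 / 2)\<close> and \<open>d n powr (1 / 4)\<close>, and both
        vanish.\<close>
      define s where "s = d n powr (- 1 / 2)"
      have s: "s > 0" using d_pos[of n] by (simp add: s_def)
      have "(LINT z|sample_law \<theta> n. f n z) \<le> (s * e n + exp (real n * (b n)\<^sup>2) / s) / 2"
        unfolding e_def P0_def
        by (rule expectation_change[OF Theta_measurable[OF th]])
          (use fm f01 s b0 in \<open>auto simp: \<theta>_def indicator_def P0_def\<close>)
      also have "\<dots> \<le> (s * d n + exp (real n * (b n)\<^sup>2) / s) / 2"
        using s by (simp add: d_def)
      also have "s * d n = d n powr (1 / 2)"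
        using d_pos[of n] powr_add[of "d n" "- 1 / 2" 1] by (simp add: s_def)
      also have "exp (real n * (b n)\<^sup>2) = d n powr (- 1 / 4)"
        using d_pos[of n] elim by (simp add: bsq powr_def c_def)
      also have "d n powr (- 1 / 4) / s = d n powr (1 / 4)"
        using d_pos[of n] powr_diff[of "d n" "- 1 / 4" "- 1 / 2"] by (simp add: s_def)
      also have "d n powr (1 / 2) \<le> d n powr (1 / 4)"
        using d_pos[of n] elim by (intro powr_mono') auto
      finally have "(LINT z|sample_law \<theta> n. f n z) \<le> d n powr (1 / 4)" by simp
      moreover have "(LINT z|sample_law \<theta> n. f n z) = 1 - (LINT z|sample_law \<theta> n. posterior \<pi> n z ?T1)"
        unfolding f_def using int[OF th T1] by (simp add: prob_space)
      moreover have "(LINT z|sample_law \<theta> n. posterior \<pi> n z ?T1) \<le> ?E n \<theta>"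
        using int[OF th T1] int[OF th A[OF th]] posterior_mono[OF pr _ T1 A[OF th] sub]
        by (intro integral_mono) auto
      \<comment> \<open>The common bound 1 on the expectations makes the real supremum a genuine
        upper bound.\<close>
      moreover have "?E n \<theta> \<le> (SUP \<theta>'\<in>Theta kmax K \<delta>. ?E n \<theta>')"
        using E_le th by (intro cSUP_upper) (auto intro!: bdd_aboveI2[where M = 1])
      ultimately show ?case by linarith
    qed
  qed
  have "(\<lambda>n. 1 - d n powr (1 / 4)) \<longlonglongrightarrow> 1"
  proof -
    \<comment> \<open>Here \<open>0 powr (1 / 4)\<close> is 0, so the lower bound tends to
      1.\<close>
    have "(\<lambda>n. d n powr (1 / 4)) \<longlonglongrightarrow> 0 powr (1 / 4)"
      using d_pos by (intro tendsto_powr' d0 tendsto_const) (auto intro!: always_eventually simp: less_imp_le)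
    from tendsto_diff[OF tendsto_const this, of 1] show ?thesis by simp
  qed
  from tendsto_sandwich[OF lower always_eventually this tendsto_const] upper
  have "(\<lambda>n. SUP \<theta>'\<in>Theta kmax K \<delta>. ?E n \<theta>') \<longlonglongrightarrow> 1" by blast
  with M_top show ?thesis by blast
qed

end
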